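(* Fix a finite set $\mathcal{P}$ of atomic propositions, a Kripke structure $M$ over $\mathcal{P}$ and a positive integer $B$. Assume $\mathtt{Infer}$ is a procedure which, given $M$, $B$, a finite set $N$ of Kripke structures over $\mathcal{P}$ and a finite set $D$ of CTL formulas, returns a CTL formula $\Phi'$ such that $M\models\Phi'$, $|\Phi'|\le B$, $M''\not\models\Phi'$ for every $M''\in N$, and $\Phi'\notin D$ (syntactically), whenever such a formula exists, and otherwise reports that no such formula exists. Consider the following algorithm (CEG algorithm) on input $M,B$: set $N:=\emptyset$, $D:=\emptyset$, $\Phi:=\mathit{true}$; while $\mathtt{Infer}(M,B,N,D)$ returns a CTL formula $\Phi'$, do: if $\Phi'\leftrightarrow\Phi$, add $\Phi'$ to $D$; otherwise, if $\Phi'\rightarrow\Phi$, choose a Kripke structure $M'$ with $M'\models\Phi\wedge\neg\Phi'$, add $M'$ to $N$, add $\Phi'$ to $D$, and set $\Phi:=\Phi'$; otherwise (i.e. $\Phi'\not\rightarrow\Phi$) choose a Kripke structure $M'$ with $M'\models\Phi'\wedge\neg\Phi$ and add $M'$ to $N$. When $\mathtt{Infer}$ reports that no formula exists, return $\Phi$. Then this algorithm terminates (for any choices of the structures $M'$) and the formula $\Phi$ it returns is a solution to the CTL Inference problem for $M$ and $B$, i.e. (1) $M\models\Phi$, (2) $|\Phi|\le B$, and (3) for every CTL formula $\Phi''$ with $M\models\Phi''$ and $|\Phi''|\le B$, we have $\Phi''\not\rightarrow\Phi$ or $\Phi\rightarrow\Phi''$.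
   Context: A Kripke structure over $\mathcal{P}$ is $M=(S,I,R,L)$ with a set of states $S$, initial states $I\subseteq S$, a transition relation $R\subseteq S\times S$ such that every state has at least one successor, and a labeling $L:S\to 2^{\mathcal{P}}$; $\mathrm{post}(s)=\{s'\mid (s,s')\in R\}$. A path is an infinite sequence $\pi=s_0s_1\dots$ with $s_{i+1}\in\mathrm{post}(s_i)$; $\pi[i]$ is its $i$-th state; $\mathrm{paths}(s)$ is the set of paths starting at $s$. CTL state formulas: $\Phi ::= \mathit{true}\mid\mathit{false}\mid p\mid\neg\Phi\mid\Phi\wedge\Phi\mid \mathsf{E}\varphi\mid\mathsf{A}\varphi$ ($p\in\mathcal{P}$), path formulas $\varphi::=\mathsf{X}\Phi\mid \Phi\,\mathsf{U}\,\Phi$ (other Boolean connectives and $\mathsf{F},\mathsf{G}$ are the usual abbreviations, $\circ\mathsf{F}\Phi=\circ(\mathit{true}\,\mathsf{U}\,\Phi)$, $\circ\mathsf{G}\Phi=\neg\circ\mathsf{F}\neg\Phi$ for $\circ\in\{\mathsf{E},\mathsf{A}\}$). Semantics: $s\models p$ iff $p\in L(s)$; $\neg,\wedge$ as usual; $s\models\mathsf{E}\varphi$ (resp. $\mathsf{A}\varphi$) iff some (resp. every) $\pi\in\mathrm{paths}(s)$ satisfies $\varphi$; $\pi\models\mathsf{X}\Phi$ iff $\pi[1]\models\Phi$; $\pi\models\Phi_1\mathsf{U}\Phi_2$ iff there is $j\ge0$ with $\pi[j]\models\Phi_2$ and $\pi[k]\models\Phi_1$ for all $0\le k<j$. $M\models\Phi$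 iff $s\models\Phi$ for all $s\in I$. For CTL formulas, $\Phi_1\rightarrow\Phi_2$ means every Kripke structure satisfying $\Phi_1$ satisfies $\Phi_2$, and $\Phi_1\leftrightarrow\Phi_2$ means both implications hold. The size $|\Phi|$ is the number of distinct subformulas of $\Phi$, where $\mathit{sub}(p)=\{p\}$ (likewise for constants), $\mathit{sub}(\neg\Phi)=\{\neg\Phi\}\cup\mathit{sub}(\Phi)$, $\mathit{sub}(\Phi_1\wedge\Phi_2)=\{\Phi_1\wedge\Phi_2\}\cup\mathit{sub}(\Phi_1)\cup\mathit{sub}(\Phi_2)$, $\mathit{sub}(\circ\mathsf{X}\Phi)=\{\circ\mathsf{X}\Phi\}\cup\mathit{sub}(\Phi)$, $\mathit{sub}(\circ(\Phi_1\mathsf{U}\Phi_2))=\{\circ(\Phi_1\mathsf{U}\Phi_2)\}\cup\mathit{sub}(\Phi_1)\cup\mathit{sub}(\Phi_2)$.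
   Formalization: The chosen structures M' must have at least one initial state, since otherwise M' satisfies every formula and the claim fails; all Kripke structures take their states from one arbitrary infinite set, over which → agrees with → over all Kripke structures. *)

theory Defs
  imports Main "HOL-Library.Countable_Set"
begin

record ('s, 'p) kripke =
  states :: "'s set"
  init :: "'s set"
  transitions :: "('s \<times> 's) set"
  label :: "'s \<Rightarrow> 'p set"

definition is_kripke :: "'p set \<Rightarrow> ('s, 'p) kripke \<Rightarrow> bool" where
  "is_kripke P K \<longleftrightarrow>
     init K \<subseteq> states K \<and>
     transitions K \<subseteq> states K \<times> states K \<and>
     (\<forall>s \<in> states K. \<exists>s'. (s, s') \<in> transitions K) \<and>
     (\<forall>s \<in> states K. label K s \<subseteq> P)"

definition post :: "('s, 'p) kripke \<Rightarrow> 's \<Rightarrow> 's set" where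
  "post K s = {s'. (s, s') \<in> transitions K}"

definition paths :: "('s, 'p) kripke \<Rightarrow> 's \<Rightarrow> (nat \<Rightarrow> 's) set" where
  "paths K s = {\<pi>. \<pi> 0 = s \<and> (\<forall>i. \<pi> (Suc i) \<in> post K (\<pi> i))}"

datatype 'p ctl =
    CTrue
  | CFalse
  | Prop 'p
  | Neg "'p ctl"
  | Conj "'p ctl" "'p ctl"
  | Exists_Path "'p ctl_path"
  | All_Paths "'p ctl_path"
and 'p ctl_path =
    Next "'p ctl"
  | Until "'p ctl" "'p ctl"

definition ctl_over :: "'p set \<Rightarrow> 'p ctl set" where
  "ctl_over P = {\<Phi>. set_ctl \<Phi> \<subseteq> P}"

primrec sat :: "('s, 'p) kripke \<Rightarrow> 'p ctl \<Rightarrow> 's \<Rightarrow> bool"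
  and path_sat :: "('s, 'p) kripke \<Rightarrow> 'p ctl_path \<Rightarrow> (nat \<Rightarrow> 's) \<Rightarrow> bool"
where
  "sat K CTrue s = True"
| "sat K CFalse s = False"
| "sat K (Prop p) s = (p \<in> label K s)"
| "sat K (Neg \<Phi>) s = (\<not> sat K \<Phi> s)"
| "sat K (Conj \<Phi> \<Psi>) s = (sat K \<Phi> s \<and> sat K \<Psi> s)"
| "sat K (Exists_Path \<phi>) s = (\<exists>\<pi> \<in> paths K s. path_sat K \<phi> \<pi>)"
| "sat K (All_Paths \<phi>) s = (\<forall>\<pi> \<in> paths K s. path_sat K \<phi> \<pi>)"
| "path_sat K (Next \<Phi>) \<pi> = sat K \<Phi> (\<pi> 1)"
| "path_sat K (Until \<Phi> \<Psi>) \<pi> = (\<exists>j. sat K \<Psi> (\<pi> j) \<and> (\<forall>k < j. sat K \<Phi> (\<pi> k)))"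

definition models :: "('s, 'p) kripke \<Rightarrow> 'p ctl \<Rightarrow> bool" where
  "models K \<Phi> \<longleftrightarrow> (\<forall>s \<in> init K. sat K \<Phi> s)"

primrec sub :: "'p ctl \<Rightarrow> 'p ctl set"
  and path_sub :: "'p ctl_path \<Rightarrow> 'p ctl set"
where
  "sub CTrue = {CTrue}"
| "sub CFalse = {CFalse}"
| "sub (Prop p) = {Prop p}"
| "sub (Neg \<Phi>) = insert (Neg \<Phi>) (sub \<Phi>)"
| "sub (Conj \<Phi> \<Psi>) = insert (Conj \<Phi> \<Psi>) (sub \<Phi> \<union> sub \<Psi>)"
| "sub (Exists_Path \<phi>) = insert (Exists_Path \<phi>) (path_sub \<phi>)"
| "sub (All_Paths \<phi>) = insert (All_Paths \<phi>) (path_sub \<phi>)"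
| "path_sub (Next \<Phi>) = sub \<Phi>"
| "path_sub (Until \<Phi> \<Psi>) = sub \<Phi> \<union> sub \<Psi>"

definition ctl_size :: "'p ctl \<Rightarrow> nat" where
  "ctl_size \<Phi> = card (sub \<Phi>)"

text \<open>
  HOL cannot quantify over state types inside a formula, so the relation \<open>\<Phi> \<rightarrow> \<Psi>\<close> ranges over all
  Kripke structures whose states are drawn from one type \<open>'s\<close>. For infinite \<open>'s\<close> this is the same as
  ranging over Kripke structures on arbitrary types: see \<open>ctl_implies_all_types\<close> at the end.
\<close>

definition ctl_implies :: "'s itself \<Rightarrow> 'p set \<Rightarrow> 'p ctl \<Rightarrow> 'p ctl \<Rightarrow> bool" where
  "ctl_implies (_ :: 's itself) P \<Phi> \<Psi> \<longleftrightarrow>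
     (\<forall>K :: ('s, 'p) kripke. is_kripke P K \<longrightarrow> models K \<Phi> \<longrightarrow> models K \<Psi>)"

definition ctl_equiv :: "'s itself \<Rightarrow> 'p set \<Rightarrow> 'p ctl \<Rightarrow> 'p ctl \<Rightarrow> bool" where
  "ctl_equiv T P \<Phi> \<Psi> \<longleftrightarrow> ctl_implies T P \<Phi> \<Psi> \<and> ctl_implies T P \<Psi> \<Phi>"

definition ctl_solution :: "'p set \<Rightarrow> ('s, 'p) kripke \<Rightarrow> nat \<Rightarrow> 'p ctl \<Rightarrow> bool" where
  "ctl_solution P (M :: ('s, 'p) kripke) B \<Phi> \<longleftrightarrow>
     \<Phi> \<in> ctl_over P \<and> models M \<Phi> \<and> ctl_size \<Phi> \<le> B \<and>
     (\<forall>\<Phi>'' \<in> ctl_over P. models M \<Phi>'' \<and> ctl_size \<Phi>'' \<le> B \<longrightarrow>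
        \<not> ctl_implies TYPE('s) P \<Phi>'' \<Phi> \<or> ctl_implies TYPE('s) P \<Phi> \<Phi>'')"

type_synonym ('s, 'p) infer_proc =
  "('s, 'p) kripke \<Rightarrow> nat \<Rightarrow> ('s, 'p) kripke set \<Rightarrow> 'p ctl set \<Rightarrow> 'p ctl option"

definition infer_candidate ::
  "'p set \<Rightarrow> ('s, 'p) kripke \<Rightarrow> nat \<Rightarrow> ('s, 'p) kripke set \<Rightarrow> 'p ctl set \<Rightarrow> 'p ctl \<Rightarrow> bool" where
  "infer_candidate P M B N D \<Phi>' \<longleftrightarrow>
     \<Phi>' \<in> ctl_over P \<and> models M \<Phi>' \<and> ctl_size \<Phi>' \<le> B \<and>
     (\<forall>M'' \<in> N. \<not> models M'' \<Phi>') \<and> \<Phi>' \<notin> D"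

definition infer_correct ::
  "'p set \<Rightarrow> ('s, 'p) kripke \<Rightarrow> nat \<Rightarrow> ('s, 'p) infer_proc \<Rightarrow> bool" where
  "infer_correct P M B infer \<longleftrightarrow>
     (\<forall>N D. finite N \<and> (\<forall>M'' \<in> N. is_kripke P M'') \<and> finite D \<and> D \<subseteq> ctl_over P \<longrightarrow>
        (case infer M B N D of
           Some \<Phi>' \<Rightarrow> infer_candidate P M B N D \<Phi>'
         | None \<Rightarrow> \<not> (\<exists>\<Phi>'. infer_candidate P M B N D \<Phi>')))"

text \<open>
  A structure without initial states is a model of every formula, in particular of \<open>\<Phi> \<and> \<not> \<Psi>\<close>, yet it
  witnesses nothing; the structures the algorithm chooses must have an initial state.
\<close>

definition separates :: "'p set \<Rightarrow> 'p ctl \<Rightarrow> 'p ctl \<Rightarrow> ('s, 'p) kripke \<Rightarrow> bool" where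
  "separates P \<Phi> \<Psi> M' \<longleftrightarrow> is_kripke P M' \<and> init M' \<noteq> {} \<and> models M' (Conj \<Phi> (Neg \<Psi>))"

type_synonym ('s, 'p) ceg_config = "('s, 'p) kripke set \<times> 'p ctl set \<times> 'p ctl"

definition ceg_init :: "('s, 'p) ceg_config" where
  "ceg_init = ({}, {}, CTrue)"

inductive ceg_step ::
  "'p set \<Rightarrow> ('s, 'p) kripke \<Rightarrow> nat \<Rightarrow> ('s, 'p) infer_proc \<Rightarrow>
   ('s, 'p) ceg_config \<Rightarrow> ('s, 'p) ceg_config \<Rightarrow> bool"
  for P :: "'p set" and M :: "('s, 'p) kripke" and B :: nat and infer :: "('s, 'p) infer_proc"
where
  equivalent:
    "infer M B N D = Some \<Phi>' \<Longrightarrow>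
     ctl_equiv TYPE('s) P \<Phi>' \<Phi> \<Longrightarrow>
     ceg_step P M B infer (N, D, \<Phi>) (N, insert \<Phi>' D, \<Phi>)"
| stronger:
    "infer M B N D = Some \<Phi>' \<Longrightarrow>
     \<not> ctl_equiv TYPE('s) P \<Phi>' \<Phi> \<Longrightarrow>
     ctl_implies TYPE('s) P \<Phi>' \<Phi> \<Longrightarrow>
     separates P \<Phi> \<Phi>' M' \<Longrightarrow>
     ceg_step P M B infer (N, D, \<Phi>) (insert M' N, insert \<Phi>' D, \<Phi>')"
| not_stronger:
    "infer M B N D = Some \<Phi>' \<Longrightarrow>
     \<not> ctl_equiv TYPE('s) P \<Phi>' \<Phi> \<Longrightarrow>
     \<not> ctl_implies TYPE('s) P \<Phi>' \<Phi> \<Longrightarrow>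
     separates P \<Phi>' \<Phi> M' \<Longrightarrow>
     ceg_step P M B infer (N, D, \<Phi>) (insert M' N, D, \<Phi>)"

definition ceg_reachable ::
  "'p set \<Rightarrow> ('s, 'p) kripke \<Rightarrow> nat \<Rightarrow> ('s, 'p) infer_proc \<Rightarrow> ('s, 'p) ceg_config \<Rightarrow> bool" where
  "ceg_reachable P M B infer c \<longleftrightarrow> (ceg_step P M B infer)\<^sup>*\<^sup>* ceg_init c"

text \<open>
  The first conjunct says that every run is finite, the second that no run blocks, i.e. that whenever
  the loop body is entered a structure as required by the body exists.
\<close>

definition ceg_terminates ::
  "'p set \<Rightarrow> ('s, 'p) kripke \<Rightarrow> nat \<Rightarrow> ('s, 'p) infer_proc \<Rightarrow> bool" where
  "ceg_terminates P M B infer \<longleftrightarrow>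
     \<not> (\<exists>c. c 0 = ceg_init \<and> (\<forall>i :: nat. ceg_step P M B infer (c i) (c (Suc i)))) \<and>
     (\<forall>N D \<Phi>. ceg_reachable P M B infer (N, D, \<Phi>) \<and> infer M B N D \<noteq> None \<longrightarrow>
        (\<exists>c'. ceg_step P M B infer (N, D, \<Phi>) c'))"

definition ceg_returns ::
  "'p set \<Rightarrow> ('s, 'p) kripke \<Rightarrow> nat \<Rightarrow> ('s, 'p) infer_proc \<Rightarrow> 'p ctl \<Rightarrow> bool" where
  "ceg_returns P M B infer \<Phi> \<longleftrightarrow>
     (\<exists>N D. ceg_reachable P M B infer (N, D, \<Phi>) \<and> infer M B N D = None)"

lemma finite_sub:
  fixes \<Phi> :: "'p ctl" and \<phi> :: "'p ctl_path"
  shows "finite (sub \<Phi>)" and "finite (path_sub \<phi>)"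
  by (induction \<Phi> and \<phi>) auto

lemma path_in_states:
  assumes "is_kripke P K" "\<pi> \<in> paths K s" "s \<in> states K"
  shows "\<pi> i \<in> states K"
proof (cases i)
  case 0
  then show ?thesis using assms by (simp add: paths_def)
next
  case (Suc j)
  have "(\<pi> j, \<pi> (Suc j)) \<in> transitions K"
    using assms(2) by (simp add: paths_def post_def)
  then show ?thesis using assms(1) Suc by (auto simp: is_kripke_def)
qed

lemma paths_nonempty:
  assumes "is_kripke P K" "s \<in> states K"
  shows "\<exists>\<pi>. \<pi> \<in> paths K s"
proof -
  define f where "f = (\<lambda>s. SOME s'. (s, s') \<in> transitions K)"
  have f: "(t, f t) \<in> transitions K" if "t \<in> states K" for t
    using assms(1) that someI_ex[of "\<lambda>s'. (t, s') \<in> transitions K"]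
    by (simp add: f_def is_kripke_def)
  have f_states: "f t \<in> states K" if "t \<in> states K" for t
    using f[OF that] assms(1) by (auto simp: is_kripke_def)
  have "(f ^^ i) s \<in> states K" for i
    by (induction i) (simp_all add: assms(2) f_states)
  then have "(\<lambda>i. (f ^^ i) s) \<in> paths K s"
    by (simp add: paths_def post_def f)
  then show ?thesis by blast
qed

lemma countable_substructure:
  fixes K :: "('t, 'p) kripke"
  assumes K: "is_kripke P K" and s0: "s0 \<in> states K" and F: "finite F"
  obtains K' :: "('t, 'p) kripke" where
    "is_kripke P K'" "countable (states K')" "s0 \<in> states K'" "init K' = {s0}"
    "\<And>\<Phi> s. s \<in> states K' \<Longrightarrow> sub \<Phi> \<subseteq> F \<Longrightarrow> sat K' \<Phi> s \<longleftrightarrow> sat K \<Phi> s"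
proof -
  define G where "G = insert undefined (Exists_Path -` F \<union> All_Paths -` F)"
  have G: "finite G"
    unfolding G_def using F by (auto intro!: finite_vimageI simp: inj_def)
  define W where "W = (\<lambda>b \<phi> s. if \<exists>\<pi> \<in> paths K s. path_sat K \<phi> \<pi> = b
    then SOME \<pi>. \<pi> \<in> paths K s \<and> path_sat K \<phi> \<pi> = b else SOME \<pi>. \<pi> \<in> paths K s)"
  have W: "W b \<phi> s \<in> paths K s" if "s \<in> states K" for b \<phi> s
  proof (cases "\<exists>\<pi> \<in> paths K s. path_sat K \<phi> \<pi> = b")
    case True
    then have "\<exists>\<pi>. \<pi> \<in> paths K s \<and> path_sat K \<phi> \<pi> = b" by blast
    from someI_ex[OF this] True show ?thesis unfolding W_def by auto
  next
    case False
    from someI_ex[OF paths_nonempty[OF K that]] False show ?thesis unfolding W_def by auto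
  qed
  have W': "path_sat K \<phi> (W b \<phi> s) = b" if "\<pi> \<in> paths K s" "path_sat K \<phi> \<pi> = b" for b \<phi> s \<pi>
  proof -
    have "\<exists>\<pi>. \<pi> \<in> paths K s \<and> path_sat K \<phi> \<pi> = b" using that by blast
    from someI_ex[OF this] that show ?thesis unfolding W_def by auto
  qed
  define N where "N = (\<lambda>A. \<Union>s \<in> A. \<Union>b \<in> UNIV. \<Union>\<phi> \<in> G. range (W b \<phi> s))"
  define T where "T = (\<Union>n. (N ^^ n) {s0})"
  have "countable ((N ^^ n) {s0})" for n
  proof (induction n)
    case (Suc n)
    have "countable (N A)" if "countable A" for A
      unfolding N_def using that G by (intro countable_UN) (auto intro: countable_finite)
    with Suc show ?case by simp
  qed simp
  then have T_count: "countable T" unfolding T_def by auto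
  have s0T: "s0 \<in> T" unfolding T_def by (rule UN_I[of 0]) auto
  have T_closed: "W b \<phi> s i \<in> T" if s: "s \<in> T" and \<phi>: "\<phi> \<in> G" for b \<phi> s i
  proof -
    from s obtain n where "s \<in> (N ^^ n) {s0}" unfolding T_def by auto
    moreover have "W b \<phi> s i \<in> N A" if "s \<in> A" for A
      using that \<phi> unfolding N_def by blast
    ultimately have "W b \<phi> s i \<in> (N ^^ Suc n) {s0}" by simp
    then show ?thesis unfolding T_def by blast
  qed
  have T_states: "T \<subseteq> states K"
  proof -
    have "(N ^^ n) {s0} \<subseteq> states K" for n
    proof (induction n)
      case (Suc n)
      then show ?case
        using path_in_states[OF K W] by (auto simp: N_def)
    qed (use s0 in auto)
    then show ?thesis unfolding T_def by auto
  qed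
  define K' where "K' = \<lparr>states = T, init = {s0}, transitions = transitions K \<inter> T \<times> T, label = label K\<rparr>"
  have trK'[simp]: "transitions K' = transitions K \<inter> T \<times> T" by (simp add: K'_def)
  have [simp]: "states K' = T" "init K' = {s0}" "label K' = label K"
    by (simp_all add: K'_def)
  have WK': "W b \<phi> s \<in> paths K' s" if "s \<in> T" "\<phi> \<in> G" for b \<phi> s
    using W[of s b \<phi>] T_closed[OF that] that T_states by (auto simp: paths_def post_def)
  have "\<exists>s'. (s, s') \<in> transitions K \<inter> T \<times> T" if "s \<in> T" for s
  proof -
    have "W True undefined s \<in> paths K' s" using WK'[OF that] by (simp add: G_def)
    then have "W True undefined s 0 = s"
      "(W True undefined s 0, W True undefined s (Suc 0)) \<in> transitions K \<inter> T \<times> T"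
      unfolding paths_def post_def mem_Collect_eq trK' by blast+
    then show ?thesis by auto
  qed
  then have is_K': "is_kripke P K'"
    using K T_states s0T by (auto simp: is_kripke_def)
  have paths_sub: "paths K' s \<subseteq> paths K s" for s
    by (auto simp: paths_def post_def)
  have in_T: "\<pi> i \<in> T" if "\<pi> \<in> paths K' s" "s \<in> T" for \<pi> s i
    using path_in_states[OF is_K' that(1)] that(2) by simp
  have quant: "(\<exists>\<pi> \<in> paths K' s. path_sat K' \<phi> \<pi>) \<longleftrightarrow> (\<exists>\<pi> \<in> paths K s. path_sat K \<phi> \<pi>)"
       "(\<forall>\<pi> \<in> paths K' s. path_sat K' \<phi> \<pi>) \<longleftrightarrow> (\<forall>\<pi> \<in> paths K s. path_sat K \<phi> \<pi>)"
    if IH: "\<And>\<pi>. \<forall>i. \<pi> i \<in> T \<Longrightarrow> path_sat K' \<phi> \<pi> \<longleftrightarrow> path_sat K \<phi> \<pi>"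
      and s: "s \<in> T" and \<phi>: "\<phi> \<in> G" for \<phi> s
  proof -
    have eq: "path_sat K' \<phi> \<pi> \<longleftrightarrow> path_sat K \<phi> \<pi>" if "\<pi> \<in> paths K' s" for \<pi>
      using IH in_T[OF that s] by blast
    show "(\<exists>\<pi> \<in> paths K' s. path_sat K' \<phi> \<pi>) \<longleftrightarrow> (\<exists>\<pi> \<in> paths K s. path_sat K \<phi> \<pi>)"
    proof
      assume "\<exists>\<pi> \<in> paths K' s. path_sat K' \<phi> \<pi>"
      then show "\<exists>\<pi> \<in> paths K s. path_sat K \<phi> \<pi>" using eq paths_sub by blast
    next
      assume "\<exists>\<pi> \<in> paths K s. path_sat K \<phi> \<pi>"
      then obtain \<pi> where "\<pi> \<in> paths K s" "path_sat K \<phi> \<pi>" by blast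
      then have "path_sat K \<phi> (W True \<phi> s)" using W'[of \<pi> s \<phi> True] by simp
      then show "\<exists>\<pi> \<in> paths K' s. path_sat K' \<phi> \<pi>" using eq WK'[OF s \<phi>] by blast
    qed
    show "(\<forall>\<pi> \<in> paths K' s. path_sat K' \<phi> \<pi>) \<longleftrightarrow> (\<forall>\<pi> \<in> paths K s. path_sat K \<phi> \<pi>)"
    proof
      assume *: "\<forall>\<pi> \<in> paths K' s. path_sat K' \<phi> \<pi>"
      show "\<forall>\<pi> \<in> paths K s. path_sat K \<phi> \<pi>"
      proof (rule ccontr)
        assume "\<not> ?thesis"
        then obtain \<pi> where "\<pi> \<in> paths K s" "\<not> path_sat K \<phi> \<pi>" by blast
        then have "\<not> path_sat K \<phi> (W False \<phi> s)" using W'[of \<pi> s \<phi> False] by simp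
        then show False using * eq WK'[OF s \<phi>] by blast
      qed
    next
      assume "\<forall>\<pi> \<in> paths K s. path_sat K \<phi> \<pi>"
      then show "\<forall>\<pi> \<in> paths K' s. path_sat K' \<phi> \<pi>" using eq paths_sub by blast
    qed
  qed
  have "s \<in> T \<Longrightarrow> sub \<Phi> \<subseteq> F \<Longrightarrow> sat K' \<Phi> s \<longleftrightarrow> sat K \<Phi> s"
    and "\<forall>i. \<pi> i \<in> T \<Longrightarrow> path_sub \<phi> \<subseteq> F \<Longrightarrow> path_sat K' \<phi> \<pi> \<longleftrightarrow> path_sat K \<phi> \<pi>" for \<Phi> \<phi> s \<pi>
  proof (induction \<Phi> and \<phi> arbitrary: s and \<pi>)
    case (Exists_Path \<phi>)
    then have "\<phi> \<in> G" by (auto simp: G_def)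
    with Exists_Path quant(1)[of \<phi> s] show ?case by simp
  next
    case (All_Paths \<phi>)
    then have "\<phi> \<in> G" by (auto simp: G_def)
    with All_Paths quant(2)[of \<phi> s] show ?case by simp
  next
    case (Until \<Phi> \<Psi>)
    then have "sat K' \<Phi> (\<pi> i) = sat K \<Phi> (\<pi> i)" "sat K' \<Psi> (\<pi> i) = sat K \<Psi> (\<pi> i)" for i
      by auto
    then show ?case by simp
  qed auto
  then show thesis
    using that[of K'] is_K' T_count s0T by simp
qed

lemma sat_image:
  fixes K :: "('t, 'p) kripke" and g :: "'t \<Rightarrow> 's"
  assumes K: "is_kripke P K" and g: "inj_on g (states K)"
  obtains K' :: "('s, 'p) kripke" where
    "is_kripke P K'" "init K' = g ` init K"
    "\<And>\<Phi> s. s \<in> states K \<Longrightarrow> sat K' \<Phi> (g s) \<longleftrightarrow> sat K \<Phi> s"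
proof -
  define h where "h = inv_into (states K) g"
  have hg: "h (g s) = s" if "s \<in> states K" for s
    unfolding h_def using g that by simp
  define K' where "K' = \<lparr>states = g ` states K, init = g ` init K,
    transitions = (\<lambda>(s, t). (g s, g t)) ` transitions K, label = label K \<circ> h\<rparr>"
  have [simp]: "states K' = g ` states K" "init K' = g ` init K"
    "transitions K' = (\<lambda>(s, t). (g s, g t)) ` transitions K" "label K' = label K \<circ> h"
    by (simp_all add: K'_def)
  have is_K': "is_kripke P K'"
    unfolding is_kripke_def
  proof (intro conjI ballI)
    show "init K' \<subseteq> states K'" "transitions K' \<subseteq> states K' \<times> states K'"
      using K by (auto simp: is_kripke_def)
  next
    fix s assume "s \<in> states K'"
    then obtain a where a: "a \<in> states K" "s = g a" by auto
    then obtain b where "(a, b) \<in> transitions K" using K by (auto simp: is_kripke_def)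
    with a show "\<exists>s'. (s, s') \<in> transitions K'" by auto
    from a K hg show "label K' s \<subseteq> P" by (simp add: is_kripke_def)
  qed
  have paths_eq: "paths K' (g s) = (\<lambda>\<pi>. g \<circ> \<pi>) ` paths K s" if s: "s \<in> states K" for s
  proof (intro equalityI subsetI)
    fix \<pi> assume \<pi>: "\<pi> \<in> paths K' (g s)"
    have in_im: "\<pi> i \<in> g ` states K" for i
      using path_in_states[OF is_K' \<pi>] s by simp
    have "(h (\<pi> i), h (\<pi> (Suc i))) \<in> transitions K" for i
    proof -
      have "(\<pi> i, \<pi> (Suc i)) \<in> transitions K'"
        using \<pi> by (simp add: paths_def post_def)
      then obtain a b where ab: "(a, b) \<in> transitions K" "\<pi> i = g a" "\<pi> (Suc i) = g b"
        by auto
      with K have "a \<in> states K" "b \<in> states K" by (auto simp: is_kripke_def)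
      with ab hg show ?thesis by simp
    qed
    moreover have "h (\<pi> 0) = s"
      using \<pi> hg[OF s] by (simp add: paths_def)
    ultimately have "h \<circ> \<pi> \<in> paths K s"
      by (simp add: paths_def post_def)
    moreover have "g \<circ> (h \<circ> \<pi>) = \<pi>"
      using in_im by (auto simp: h_def f_inv_into_f fun_eq_iff)
    ultimately show "\<pi> \<in> (\<lambda>\<pi>. g \<circ> \<pi>) ` paths K s" by (metis image_eqI)
  next
    fix \<pi> assume "\<pi> \<in> (\<lambda>\<pi>. g \<circ> \<pi>) ` paths K s"
    then show "\<pi> \<in> paths K' (g s)"
      by (force simp: paths_def post_def)
  qed
  have "s \<in> states K \<Longrightarrow> sat K' \<Phi> (g s) \<longleftrightarrow> sat K \<Phi> s"
    and "\<forall>i. \<pi> i \<in> states K \<Longrightarrow> path_sat K' \<phi> (g \<circ> \<pi>) \<longleftrightarrow> path_sat K \<phi> \<pi>" for \<Phi> \<phi> s \<pi>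
  proof (induction \<Phi> and \<phi> arbitrary: s and \<pi>)
    case (Exists_Path \<phi>)
    have "\<forall>i. \<pi> i \<in> states K" if "\<pi> \<in> paths K s" for \<pi>
      using path_in_states[OF K that Exists_Path.prems] by auto
    then have "path_sat K' \<phi> (g \<circ> \<pi>) = path_sat K \<phi> \<pi>" if "\<pi> \<in> paths K s" for \<pi>
      using Exists_Path.IH that by blast
    then show ?case using Exists_Path.prems by (simp add: paths_eq del: o_apply)
  next
    case (All_Paths \<phi>)
    have "\<forall>i. \<pi> i \<in> states K" if "\<pi> \<in> paths K s" for \<pi>
      using path_in_states[OF K that All_Paths.prems] by auto
    then have "path_sat K' \<phi> (g \<circ> \<pi>) = path_sat K \<phi> \<pi>" if "\<pi> \<in> paths K s" for \<pi>
      using All_Paths.IH that by blast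
    then show ?case using All_Paths.prems by (simp add: paths_eq del: o_apply)
  next
    case (Until \<Phi> \<Psi>)
    then have "sat K' \<Phi> (g (\<pi> i)) = sat K \<Phi> (\<pi> i)" "sat K' \<Psi> (g (\<pi> i)) = sat K \<Psi> (\<pi> i)" for i
      by auto
    then show ?case by simp
  qed (auto simp: hg)
  then show thesis using that[of K'] is_K' by simp
qed

lemma ctl_implies_all_types:
  fixes K :: "('t, 'p) kripke"
  assumes inf: "infinite (UNIV :: 's set)"
    and imp: "ctl_implies TYPE('s) P \<Phi> \<Psi>"
    and K: "is_kripke P K" "models K \<Phi>"
  shows "models K \<Psi>"
  unfolding models_def
proof
  fix s0 assume s0: "s0 \<in> init K"
  then have s0S: "s0 \<in> states K" using K(1) by (auto simp: is_kripke_def)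
  obtain K1 :: "('t, 'p) kripke" where K1: "is_kripke P K1" "countable (states K1)"
    "s0 \<in> states K1" "init K1 = {s0}"
    and sat1: "\<And>\<chi> s. s \<in> states K1 \<Longrightarrow> sub \<chi> \<subseteq> sub \<Phi> \<union> sub \<Psi> \<Longrightarrow> sat K1 \<chi> s \<longleftrightarrow> sat K \<chi> s"
    using countable_substructure[OF K(1) s0S finite_UnI[OF finite_sub(1) finite_sub(1)], of \<Phi> \<Psi>]
    by blast
  obtain e :: "nat \<Rightarrow> 's" where e: "inj e" using inf infinite_countable_subset by blast
  define g where "g = e \<circ> to_nat_on (states K1)"
  have g: "inj_on g (states K1)"
    unfolding g_def using K1(2) e
    by (intro comp_inj_on inj_on_to_nat_on) (auto simp: inj_on_def)
  obtain K2 :: "('s, 'p) kripke" where K2: "is_kripke P K2" "init K2 = g ` init K1"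
    and sat2: "\<And>\<chi> s. s \<in> states K1 \<Longrightarrow> sat K2 \<chi> (g s) \<longleftrightarrow> sat K1 \<chi> s"
    using sat_image[OF K1(1) g] by blast
  have "models K2 \<Phi>"
    using K(2) s0 K1 K2 sat1[of s0 \<Phi>] sat2[of s0 \<Phi>] by (simp add: models_def)
  then have "models K2 \<Psi>"
    using imp K2(1) by (simp add: ctl_implies_def)
  then show "sat K \<Psi> s0"
    using K1 K2 sat1[of s0 \<Psi>] sat2[of s0 \<Psi>] by (simp add: models_def)
qed

end

theory Submission
  imports Defs
begin

text \<open>
  Every iteration removes the formula returned by \<open>Infer\<close> from the set of candidates, either through
  \<open>D\<close> or because the new structure in \<open>N\<close> satisfies it. Over a finite \<open>P\<close> only finitely many
  formulas have size at most \<open>B\<close>, so the loop terminates. Throughout, no structure in \<open>N\<close> satisfies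
  \<open>\<Phi>\<close>, and \<open>\<Phi>\<close> implies every formula in \<open>D\<close>. Hence, once no candidate is left, a formula \<open>\<Phi>''\<close>
  with \<open>\<Phi>'' \<rightarrow> \<Phi>\<close> cannot have been excluded by \<open>N\<close>, so it lies in \<open>D\<close> and \<open>\<Phi> \<rightarrow> \<Phi>''\<close>.
\<close>

section \<open>Finiteness of the set of formulas of bounded size\<close>

lemma size_sub_le:
  fixes \<Phi> \<Psi> :: "'p ctl" and \<phi> :: "'p ctl_path"
  shows "\<Psi> \<in> sub \<Phi> \<Longrightarrow> size \<Psi> \<le> size \<Phi>"
    and "\<Psi> \<in> path_sub \<phi> \<Longrightarrow> size \<Psi> \<le> size \<phi>"
  by (induction \<Phi> and \<phi>) auto

text \<open>Strictness comes from \<open>\<Phi>\<close> itself: everything in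
  \<open>sub \<Psi>\<close> has datatype size at most \<open>size \<Psi>\<close>, so
  \<open>\<Phi>\<close> is too large to occur there. The premises are stated so that simplification
  settles them for each constructor.\<close>

lemma ctl_size_less:
  assumes "sub \<Psi> \<subseteq> sub \<Phi>" "\<Phi> \<in> sub \<Phi>" "size \<Psi> < size \<Phi>"
  shows "ctl_size \<Psi> < ctl_size \<Phi>"
proof -
  have "\<Phi> \<notin> sub \<Psi>" using size_sub_le(1)[of \<Phi> \<Psi>] assms(3) by auto
  with assms have "sub \<Psi> \<subset> sub \<Phi>" by blast
  then show ?thesis unfolding ctl_size_def by (rule psubset_card_mono[OF finite_sub(1)])
qed

text \<open>Induction on the bound: a formula of size at most \<open>Suc n\<close> is an atom or a
  constructor applied to formulas of size at most \<open>n\<close>, and over a finite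
  \<open>P\<close> there are finitely many such combinations.\<close>

lemma finite_ctl_bounded_size:
  fixes P :: "'p set"
  assumes "finite P"
  shows "finite {\<Phi> \<in> ctl_over P. ctl_size \<Phi> \<le> n}"
proof (induction n)
  case 0
  have "sub \<Phi> \<noteq> {}" for \<Phi> :: "'p ctl" by (cases \<Phi>) auto
  then have "{\<Phi> \<in> ctl_over P. ctl_size \<Phi> \<le> 0} = {}"
    by (simp add: ctl_size_def finite_sub)
  then show ?case by (metis finite.emptyI)
next
  case (Suc n)
  let ?F = "{\<Phi> \<in> ctl_over P. ctl_size \<Phi> \<le> n}"
  \<comment> \<open>Path formulas have no \<open>ctl_size\<close> of their own, so they are
    enumerated through their immediate state formulas.\<close>
  let ?Q = "Next ` ?F \<union> (\<lambda>(\<Phi>, \<Psi>). Until \<Phi> \<Psi>) ` (?F \<times> ?F)"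
  let ?G = "{CTrue, CFalse} \<union> Prop ` P \<union> Neg ` ?F \<union> (\<lambda>(\<Phi>, \<Psi>). Conj \<Phi> \<Psi>) ` (?F \<times> ?F) \<union>
    Exists_Path ` ?Q \<union> All_Paths ` ?Q"
  have mem: "\<Psi> \<in> ?F"
    if "ctl_size \<Phi> \<le> Suc n" "sub \<Psi> \<subseteq> sub \<Phi>" "\<Phi> \<in> sub \<Phi>" "size \<Psi> < size \<Phi>" "set_ctl \<Psi> \<subseteq> P"
    for \<Phi> \<Psi>
    using ctl_size_less[OF that(2-4)] that(1,5) by (simp add: ctl_over_def)
  have "\<Phi> \<in> ?G" if "\<Phi> \<in> ctl_over P" and size: "ctl_size \<Phi> \<le> Suc n" for \<Phi>
  proof -
    note m = mem[OF size]
    have P: "set_ctl \<Phi> \<subseteq> P" using that(1) by (simp add: ctl_over_def)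
    show ?thesis
    proof (cases \<Phi>)
      case (Neg \<Psi>)
      have "\<Psi> \<in> ?F" by (rule m) (use Neg P in auto)
      with Neg show ?thesis by blast
    next
      case (Conj \<Psi>1 \<Psi>2)
      have "\<Psi>1 \<in> ?F" "\<Psi>2 \<in> ?F" by (rule m; use Conj P in auto)+
      with Conj show ?thesis by blast
    next
      case (Exists_Path \<phi>)
      have "\<phi> \<in> ?Q"
      proof (cases \<phi>)
        case (Next \<Psi>)
        have "\<Psi> \<in> ?F" by (rule m) (use Exists_Path Next P in auto)
        with Next show ?thesis by blast
      next
        case (Until \<Psi>1 \<Psi>2)
        have "\<Psi>1 \<in> ?F" "\<Psi>2 \<in> ?F" by (rule m; use Exists_Path Until P in auto)+
        with Until show ?thesis by blast
      qed
      with Exists_Path show ?thesis by blast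
    next
      case (All_Paths \<phi>)
      have "\<phi> \<in> ?Q"
      proof (cases \<phi>)
        case (Next \<Psi>)
        have "\<Psi> \<in> ?F" by (rule m) (use All_Paths Next P in auto)
        with Next show ?thesis by blast
      next
        case (Until \<Psi>1 \<Psi>2)
        have "\<Psi>1 \<in> ?F" "\<Psi>2 \<in> ?F" by (rule m; use All_Paths Until P in auto)+
        with Until show ?thesis by blast
      qed
      with All_Paths show ?thesis by blast
    qed (use P in auto)
  qed
  then have "{\<Phi> \<in> ctl_over P. ctl_size \<Phi> \<le> Suc n} \<subseteq> ?G" by blast
  moreover have "finite ?G"
    using assms Suc by (intro finite_UnI finite_imageI finite_cartesian_product) auto
  ultimately show ?case by (rule finite_subset)
qed

section \<open>Separating structures\<close>

lemma sat_init_update: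
  "sat (K\<lparr>init := I\<rparr>) \<Phi> s = sat K \<Phi> s"
  "path_sat (K\<lparr>init := I\<rparr>) \<phi> \<pi> = path_sat K \<phi> \<pi>"
proof -
  have "paths (K\<lparr>init := I\<rparr>) = paths K"
    by (simp add: paths_def post_def fun_eq_iff)
  then show "sat (K\<lparr>init := I\<rparr>) \<Phi> s = sat K \<Phi> s"
    "path_sat (K\<lparr>init := I\<rparr>) \<phi> \<pi> = path_sat K \<phi> \<pi>"
    by (induction \<Phi> and \<phi> arbitrary: s and \<pi>) auto
qed

text \<open>A structure violating \<open>\<Psi>\<close> may still satisfy it at some initial states,
  so it need not model \<open>Neg \<Psi>\<close>. Keeping one violating initial state as the only
  one repairs this, since satisfaction at a state does not depend on \<open>init\<close>.\<close>

lemma ex_separates: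
  fixes P :: "'p set"
  assumes "\<not> ctl_implies TYPE('s) P \<Phi> \<Psi>"
  shows "\<exists>M' :: ('s, 'p) kripke. separates P \<Phi> \<Psi> M'"
proof -
  obtain K :: "('s, 'p) kripke" and s
    where K: "is_kripke P K" "models K \<Phi>" "s \<in> init K" "\<not> sat K \<Psi> s"
    using assms by (auto simp: ctl_implies_def models_def)
  then have "separates P \<Phi> \<Psi> (K\<lparr>init := {s}\<rparr>)"
    by (auto simp: separates_def is_kripke_def models_def sat_init_update)
  then show ?thesis by blast
qed

lemma separates_models:
  assumes "separates P \<Phi> \<Psi> K"
  shows "is_kripke P K" "models K \<Phi>" "\<not> models K \<Psi>"
  using assms by (auto simp: separates_def models_def)

lemma ctl_implies_trans:
  "ctl_implies T P \<Phi> \<Psi> \<Longrightarrow> ctl_implies T P \<Psi> X \<Longrightarrow> ctl_implies T P \<Phi> X"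
  by (simp add: ctl_implies_def)

section \<open>The loop invariant\<close>

text \<open>The finiteness and well-formedness clauses are what \<open>infer_correct\<close> demands
  of its inputs; the last line is \<open>ctl_solution\<close> without its optimality
  condition.\<close>

definition ceg_invariant ::
  "'p set \<Rightarrow> ('s, 'p) kripke \<Rightarrow> nat \<Rightarrow> ('s, 'p) ceg_config \<Rightarrow> bool" where
  "ceg_invariant P M B = (\<lambda>(N, D, \<Phi>).
     finite N \<and> (\<forall>K \<in> N. is_kripke P K \<and> \<not> models K \<Phi>) \<and>
     finite D \<and> D \<subseteq> ctl_over P \<and> (\<forall>\<Psi> \<in> D. ctl_implies TYPE('s) P \<Phi> \<Psi>) \<and>
     \<Phi> \<in> ctl_over P \<and> models M \<Phi> \<and> ctl_size \<Phi> \<le> B)"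

lemma infer_Some_candidate:
  assumes "infer_correct P M B infer" "ceg_invariant P M B (N, D, \<Phi>)" "infer M B N D = Some \<Phi>'"
  shows "infer_candidate P M B N D \<Phi>'"
proof -
  have "finite N \<and> (\<forall>K \<in> N. is_kripke P K) \<and> finite D \<and> D \<subseteq> ctl_over P"
    using assms(2) by (simp add: ceg_invariant_def)
  then have "case infer M B N D of Some \<Phi>' \<Rightarrow> infer_candidate P M B N D \<Phi>'
    | None \<Rightarrow> \<not> (\<exists>\<Phi>'. infer_candidate P M B N D \<Phi>')"
    using assms(1) unfolding infer_correct_def by blast
  with assms(3) show ?thesis by simp
qed

lemma infer_None_no_candidate:
  assumes "infer_correct P M B infer" "ceg_invariant P M B (N, D, \<Phi>)" "infer M B N D = None"
  shows "\<not> infer_candidate P M B N D \<Phi>'"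
proof -
  have "finite N \<and> (\<forall>K \<in> N. is_kripke P K) \<and> finite D \<and> D \<subseteq> ctl_over P"
    using assms(2) by (simp add: ceg_invariant_def)
  then have "case infer M B N D of Some \<Phi>' \<Rightarrow> infer_candidate P M B N D \<Phi>'
    | None \<Rightarrow> \<not> (\<exists>\<Phi>'. infer_candidate P M B N D \<Phi>')"
    using assms(1) unfolding infer_correct_def by blast
  with assms(3) show ?thesis by simp
qed

text \<open>The positive bound admits \<open>CTrue\<close>, whose size is 1.\<close>

lemma ceg_invariant_init:
  assumes "B > 0"
  shows "ceg_invariant P M B ceg_init"
  using assms by (simp add: ceg_invariant_def ceg_init_def ctl_over_def models_def ctl_size_def)

lemma ceg_invariant_step:
  fixes M :: "('s, 'p) kripke"
  assumes infer: "infer_correct P M B infer"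
    and "ceg_step P M B infer c c'" "ceg_invariant P M B c"
  shows "ceg_invariant P M B c'"
  using assms(2,3)
proof cases
  case (equivalent N D \<Phi>' \<Phi>)
  then have "infer_candidate P M B N D \<Phi>'"
    using infer_Some_candidate[OF infer] assms(3) by blast
  with equivalent assms(3) show ?thesis
    by (simp add: ceg_invariant_def infer_candidate_def ctl_equiv_def)
next
  \<comment> \<open>The clause on \<open>D\<close> survives the change of formula by transitivity;
    the clause on \<open>N\<close> does because a candidate fails in every old structure and
    \<open>M'\<close> separates \<open>\<Phi>\<close> from \<open>\<Phi>'\<close>.\<close>
  case (stronger N D \<Phi>' \<Phi> M')
  then have "infer_candidate P M B N D \<Phi>'"
    using infer_Some_candidate[OF infer] assms(3) by blast
  moreover have "ctl_implies TYPE('s) P \<Phi>' \<Phi>'" by (simp add: ctl_implies_def)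
  ultimately show ?thesis
    using stronger assms(3) separates_models[OF stronger(6)]
    by (auto simp: ceg_invariant_def infer_candidate_def intro: ctl_implies_trans)
next
  case (not_stronger N D \<Phi>' \<Phi> M')
  with assms(3) separates_models[OF not_stronger(6)] show ?thesis
    by (simp add: ceg_invariant_def)
qed

lemma ceg_invariant_reachable:
  assumes "infer_correct P M B infer" "B > 0" "ceg_reachable P M B infer c"
  shows "ceg_invariant P M B c"
  using assms(3) unfolding ceg_reachable_def
  by induction (auto intro: ceg_invariant_init ceg_invariant_step assms)

section \<open>Termination\<close>

definition ceg_candidates ::
  "'p set \<Rightarrow> ('s, 'p) kripke \<Rightarrow> nat \<Rightarrow> ('s, 'p) ceg_config \<Rightarrow> 'p ctl set" where
  "ceg_candidates P M B = (\<lambda>(N, D, \<Phi>). {\<Phi>'. infer_candidate P M B N D \<Phi>'})"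

lemma finite_ceg_candidates:
  assumes "finite P"
  shows "finite (ceg_candidates P M B c)"
  by (rule finite_subset[OF _ finite_ctl_bounded_size[OF assms, of B]])
    (auto simp: ceg_candidates_def infer_candidate_def)

lemma ceg_candidates_step:
  assumes "infer_correct P M B infer" "ceg_step P M B infer c c'" "ceg_invariant P M B c"
  shows "ceg_candidates P M B c' \<subset> ceg_candidates P M B c"
proof -
  obtain N D \<Phi> where c: "c = (N, D, \<Phi>)" by (cases c)
  obtain N' D' \<Phi>' where c': "c' = (N', D', \<Phi>')" by (cases c')
  \<comment> \<open>\<open>X\<close> enters \<open>D'\<close> in the cases \<open>equivalent\<close>
    and \<open>stronger\<close>; in the case \<open>not_stronger\<close> the added structure
    satisfies it.\<close>
  obtain X where X: "infer M B N D = Some X" "X \<in> D' \<or> (\<exists>K \<in> N'. models K X)"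
    and sub: "N \<subseteq> N'" "D \<subseteq> D'"
    using assms(2) unfolding c c' by cases (auto dest: separates_models)
  have "infer_candidate P M B N D X"
    using infer_Some_candidate assms X(1) unfolding c by blast
  then have "X \<in> ceg_candidates P M B c" by (simp add: ceg_candidates_def c)
  moreover have "X \<notin> ceg_candidates P M B c'"
    using X(2) by (auto simp: ceg_candidates_def c' infer_candidate_def)
  moreover have "ceg_candidates P M B c' \<subseteq> ceg_candidates P M B c"
    using sub by (auto simp: ceg_candidates_def c c' infer_candidate_def)
  ultimately show ?thesis by blast
qed

lemma ceg_terminates:
  fixes M :: "('s, 'p) kripke"
  assumes "finite P" "B > 0" "infer_correct P M B infer"
  shows "ceg_terminates P M B infer"
  unfolding ceg_terminates_def
proof (intro conjI allI impI notI)
  assume "\<exists>c. c 0 = ceg_init \<and> (\<forall>i :: nat. ceg_step P M B infer (c i) (c (Suc i)))"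
  then obtain c where c: "c 0 = ceg_init" "\<And>i :: nat. ceg_step P M B infer (c i) (c (Suc i))"
    by blast
  have inv: "ceg_invariant P M B (c i)" for i
    by (induction i)
      (auto simp: c(1) intro: ceg_invariant_init[OF assms(2)] ceg_invariant_step[OF assms(3) c(2)])
  have "(c (Suc i), c i) \<in> measure (\<lambda>c. card (ceg_candidates P M B c))" for i
    using psubset_card_mono[OF finite_ceg_candidates[OF assms(1)]
        ceg_candidates_step[OF assms(3) c(2) inv]] by simp
  then show False
    using wf_measure wf_iff_no_infinite_down_chain by blast
next
  fix N D \<Phi>
  assume *: "ceg_reachable P M B infer (N, D, \<Phi>) \<and> infer M B N D \<noteq> None"
  then obtain \<Phi>' where \<Phi>': "infer M B N D = Some \<Phi>'" by blast
  \<comment> \<open>In the second case only the implication from \<open>\<Phi>\<close> to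
    \<open>\<Phi>'\<close> can break the equivalence, and its failure supplies the required
    \<open>M'\<close>; in the third case the failing converse does.\<close>
  consider "ctl_equiv TYPE('s) P \<Phi>' \<Phi>"
    | "ctl_implies TYPE('s) P \<Phi>' \<Phi>" "\<not> ctl_implies TYPE('s) P \<Phi> \<Phi>'"
    | "\<not> ctl_implies TYPE('s) P \<Phi>' \<Phi>"
    by (auto simp: ctl_equiv_def)
  then show "\<exists>c'. ceg_step P M B infer (N, D, \<Phi>) c'"
  proof cases
    case 1
    then show ?thesis using ceg_step.equivalent[of infer, OF \<Phi>'] by (intro exI)
  next
    case 2
    moreover obtain M' :: "('s, 'p) kripke" where "separates P \<Phi> \<Phi>' M'"
      using ex_separates[OF 2(2)] by blast
    ultimately have "ceg_step P M B infer (N, D, \<Phi>) (insert M' N, insert \<Phi>' D, \<Phi>')"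
      by (intro ceg_step.stronger[of infer, OF \<Phi>']) (simp_all add: ctl_equiv_def)
    then show ?thesis by blast
  next
    case 3
    moreover obtain M' :: "('s, 'p) kripke" where "separates P \<Phi>' \<Phi> M'"
      using ex_separates[OF 3] by blast
    ultimately have "ceg_step P M B infer (N, D, \<Phi>) (insert M' N, D, \<Phi>)"
      by (intro ceg_step.not_stronger[of infer, OF \<Phi>']) (simp_all add: ctl_equiv_def)
    then show ?thesis by blast
  qed
qed

section \<open>Optimality of the returned formula\<close>

lemma ceg_returns_solution:
  fixes M :: "('s, 'p) kripke"
  assumes "B > 0" "infer_correct P M B infer" "ceg_returns P M B infer \<Phi>"
  shows "ctl_solution P M B \<Phi>"
proof -
  obtain N D where reach: "ceg_reachable P M B infer (N, D, \<Phi>)" and none: "infer M B N D = None"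
    using assms(3) by (auto simp: ceg_returns_def)
  have inv: "ceg_invariant P M B (N, D, \<Phi>)"
    by (rule ceg_invariant_reachable[OF assms(2,1) reach])
  have "ctl_implies TYPE('s) P \<Phi> \<Psi>"
    if \<Psi>: "\<Psi> \<in> ctl_over P" "models M \<Psi>" "ctl_size \<Psi> \<le> B" "ctl_implies TYPE('s) P \<Psi> \<Phi>" for \<Psi>
  proof -
    have "\<forall>K \<in> N. \<not> models K \<Psi>"
      using inv \<Psi>(4) by (auto simp: ceg_invariant_def ctl_implies_def)
    \<comment> \<open>\<open>\<Psi>\<close> meets every other requirement on a candidate, so only
      membership in \<open>D\<close> can exclude it.\<close>
    then have "\<Psi> \<in> D"
      using infer_None_no_candidate[OF assms(2) inv none, of \<Psi>] \<Psi>
      by (auto simp: infer_candidate_def)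
    then show ?thesis using inv by (simp add: ceg_invariant_def)
  qed
  then show ?thesis
    using inv by (auto simp: ceg_invariant_def ctl_solution_def)
qed

theorem theorem1:
  fixes P :: "'p set" and M :: "('s, 'p) kripke" and B :: nat
    and infer :: "('s, 'p) infer_proc"
  assumes "infinite (UNIV :: 's set)"
    and "finite P"
    and "is_kripke P M"
    and "B > 0"
    and "infer_correct P M B infer"
  shows "ceg_terminates P M B infer \<and>
         (\<forall>\<Phi>. ceg_returns P M B infer \<Phi> \<longrightarrow> ctl_solution P M B \<Phi>)"
  using ceg_terminates[OF assms(2,4,5)] ceg_returns_solution[OF assms(4,5)] by simp

end
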